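(* The classes $\mathcal{K}_{\exp}$ and $\mathcal{K}_{\exp+}$ are closed under $M$; that is, if $\mathcal{K}\in\{\mathcal{K}_{\exp},\mathcal{K}_{\exp+}\}$ and $\mathfrak{A}\in\mathcal{K}$, then every structure that is interdefinable with the model-complete core of $\mathfrak{A}$ belongs to $\mathcal{K}$.
   Context: For a permutation group $G$ on a set $X$, $o^i_n(G)$ denotes the number of orbits of the componentwise action of $G$ on $n$-tuples from $X$ with pairwise distinct entries. $\mathcal{K}_{\exp}$ is the class of all at most countable structures $\mathfrak{A}$ such that for some constant $c$ we have $o^i_n(\mathrm{Aut}(\mathfrak{A}))\le c^n$ for all $n\ge1$. $\mathcal{K}_{\exp+}$ is the class of all at most countable structures $\mathfrak{A}$ such that for some constants $c$ and $d<1$ we have $o^i_n(\mathrm{Aut}(\mathfrak{A}))\le c\,n^{dn}$ for all $n\ge 1$. All such structures are $\omega$-categorical, meaning here: at most countable, and the automorphism group has finitely many orbits on $n$-tuples for every $n$. The model-complete core of an $\omega$-categorical structure $\mathfrak{A}$ is the (up to isomorphism unique) $\omega$-categorical structure $\mathfrak{C}$ that is homomorphically equivalent to $\mathfrak{A}$ and such that $\mathrm{Aut}(\mathfrak{C})$ is dense in $\mathrm{End}(\mathfrak{C})$, i.e. every endomorphism of $\mathfrak{C}$ agrees on every finite subset of the domain with some automorphism of $\mathfrak{C}$. $M(\mathfrak{A})$ is the class of structures interdefinable with the model-complete core of $\mathfrak{A}$. Two structures on the same domain are interdefinable if the relations of each are first-order definable without parameters in the other. *)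

theory Defs
  imports Complex_Main "HOL-Library.Countable_Set" "HOL-Algebra.Group_Action"
begin

section \<open>Relational structures\<close>

text \<open>A signature is a partial map: \<open>sig A s = Some k\<close> means that \<open>s\<close> is a relation symbol
  of arity \<open>k\<close>. The value \<open>interp A s\<close> is irrelevant for \<open>s\<close> outside the signature.\<close>

record ('s, 'a) rel_structure =
  universe :: "'a set"
  sig :: "'s \<Rightarrow> nat option"
  interp :: "'s \<Rightarrow> 'a list set"

definition tuples :: "'a set \<Rightarrow> nat \<Rightarrow> 'a list set" where
  "tuples X n = {t. length t = n \<and> set t \<subseteq> X}"

definition inj_tuples :: "'a set \<Rightarrow> nat \<Rightarrow> 'a list set" where
  "inj_tuples X n = {t \<in> tuples X n. distinct t}"

definition is_structure :: "('s, 'a) rel_structure \<Rightarrow> bool" where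
  "is_structure A \<longleftrightarrow> (\<forall>s k. sig A s = Some k \<longrightarrow> interp A s \<subseteq> tuples (universe A) k)"

section \<open>Homomorphisms and automorphisms\<close>

text \<open>Only meaningful if \<open>A\<close> and \<open>B\<close> have the same signature.\<close>

definition homomorphisms ::
  "('s, 'a) rel_structure \<Rightarrow> ('s, 'b) rel_structure \<Rightarrow> ('a \<Rightarrow> 'b) set" where
  "homomorphisms A B = {f \<in> universe A \<rightarrow> universe B.
     \<forall>s k. sig A s = Some k \<longrightarrow> (\<forall>t \<in> interp A s. map f t \<in> interp B s)}"

abbreviation endomorphisms :: "('s, 'a) rel_structure \<Rightarrow> ('a \<Rightarrow> 'a) set" where
  "endomorphisms A \<equiv> homomorphisms A A"

definition automorphisms :: "('s, 'a) rel_structure \<Rightarrow> ('a \<Rightarrow> 'a) set" where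
  "automorphisms A = {f \<in> Bij (universe A).
     \<forall>s k. sig A s = Some k \<longrightarrow>
       (\<forall>t \<in> tuples (universe A) k. t \<in> interp A s \<longleftrightarrow> map f t \<in> interp A s)}"

definition Aut :: "('s, 'a) rel_structure \<Rightarrow> ('a \<Rightarrow> 'a) monoid" where
  "Aut A = BijGroup (universe A)\<lparr>carrier := automorphisms A\<rparr>"

definition hom_equivalent ::
  "('s, 'a) rel_structure \<Rightarrow> ('s, 'b) rel_structure \<Rightarrow> bool" where
  "hom_equivalent A B \<longleftrightarrow>
     sig A = sig B \<and> homomorphisms A B \<noteq> {} \<and> homomorphisms B A \<noteq> {}"

section \<open>Orbits on tuples\<close>

text \<open>The restriction to \<open>E\<close> is what \<^locale>\<open>group_action\<close> demands; \<open>E\<close> is a set of tuples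
  closed under the componentwise action.\<close>

definition componentwise :: "'a list set \<Rightarrow> ('a \<Rightarrow> 'a) \<Rightarrow> 'a list \<Rightarrow> 'a list" where
  "componentwise E g = restrict (map g) E"

definition tuple_orbits :: "('s, 'a) rel_structure \<Rightarrow> nat \<Rightarrow> 'a list set set" where
  "tuple_orbits A n =
     orbits (Aut A) (tuples (universe A) n) (componentwise (tuples (universe A) n))"

definition inj_tuple_orbits :: "('s, 'a) rel_structure \<Rightarrow> nat \<Rightarrow> 'a list set set" where
  "inj_tuple_orbits A n =
     orbits (Aut A) (inj_tuples (universe A) n) (componentwise (inj_tuples (universe A) n))"

lemma automorphisms_preserve:
  assumes "f \<in> automorphisms A" "sig A s = Some k" "t \<in> tuples (universe A) k"
  shows "map f t \<in> interp A s \<longleftrightarrow> t \<in> interp A s"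
  using assms unfolding automorphisms_def by blast

lemma subgroup_automorphisms: "subgroup (automorphisms A) (BijGroup (universe A))"
proof (rule group.subgroupI[OF group_BijGroup])
  show "automorphisms A \<subseteq> carrier (BijGroup (universe A))"
    by (auto simp: automorphisms_def BijGroup_def)
  have "(\<lambda>x\<in>universe A. x) \<in> automorphisms A"
  proof -
    have "map (\<lambda>x\<in>universe A. x) t = t" if "t \<in> tuples (universe A) k" for t k
      using that by (auto simp: tuples_def intro!: map_idI)
    then show ?thesis by (auto simp: automorphisms_def id_Bij)
  qed
  then show "automorphisms A \<noteq> {}" by blast
next
  fix f assume f: "f \<in> automorphisms A"
  then have fB: "f \<in> Bij (universe A)" by (auto simp: automorphisms_def)
  define g where "g = (\<lambda>x\<in>universe A. inv_into (universe A) f x)"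
  have gB: "g \<in> Bij (universe A)" using restrict_inv_into_Bij[OF fB] by (simp add: g_def)
  have bij: "bij_betw f (universe A) (universe A)" using fB by (auto simp: Bij_def)
  have fg: "f (g x) = x" if "x \<in> universe A" for x
    using that bij by (auto simp: g_def bij_betw_def f_inv_into_f)
  have "t \<in> interp A s \<longleftrightarrow> map g t \<in> interp A s"
    if s: "sig A s = Some k" and t: "t \<in> tuples (universe A) k" for s k t
  proof -
    have gt: "map g t \<in> tuples (universe A) k"
      using t gB by (auto simp: tuples_def Bij_def bij_betw_def)
    have "map f (map g t) = t"
      using t fg by (auto simp: tuples_def intro!: map_idI)
    then show ?thesis using automorphisms_preserve[OF f s gt] by argo
  qed
  then have "g \<in> automorphisms A" using gB by (auto simp: automorphisms_def)
  then show "inv\<^bsub>BijGroup (universe A)\<^esub> f \<in> automorphisms A"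
    using inv_BijGroup[OF fB] by (simp add: g_def)
next
  fix f g assume f: "f \<in> automorphisms A" and g: "g \<in> automorphisms A"
  then have fB: "f \<in> Bij (universe A)" and gB: "g \<in> Bij (universe A)"
    by (auto simp: automorphisms_def)
  have "t \<in> interp A s \<longleftrightarrow> map (compose (universe A) f g) t \<in> interp A s"
    if s: "sig A s = Some k" and t: "t \<in> tuples (universe A) k" for s k t
  proof -
    have gt: "map g t \<in> tuples (universe A) k"
      using t gB by (auto simp: tuples_def Bij_def bij_betw_def)
    have "map (compose (universe A) f g) t = map f (map g t)"
      using t by (auto simp: tuples_def compose_def)
    then show ?thesis
      using automorphisms_preserve[OF f s gt] automorphisms_preserve[OF g s t] by argo
  qed
  then show "f \<otimes>\<^bsub>BijGroup (universe A)\<^esub> g \<in> automorphisms A"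
    using fB gB compose_Bij[OF fB gB] by (auto simp: automorphisms_def BijGroup_def)
qed

lemma componentwise_group_action:
  assumes E: "E = tuples (universe A) n \<or> E = inj_tuples (universe A) n"
  shows "group_action (Aut A) E (componentwise E)"
proof -
  have len: "t \<in> E \<Longrightarrow> set t \<subseteq> universe A" for t
    using E by (auto simp: tuples_def inj_tuples_def)
  have into: "map f t \<in> E" if f: "f \<in> Bij (universe A)" and t: "t \<in> E" for f t
  proof -
    have "f ` set t \<subseteq> universe A" "inj_on f (set t)"
      using f len[OF t] by (auto simp: Bij_def bij_betw_def intro: inj_on_subset)
    then show ?thesis using E t by (auto simp: tuples_def inj_tuples_def distinct_map)
  qed
  have grp: "group (Aut A)"
    unfolding Aut_def using subgroup_automorphisms group_BijGroup
    by (rule subgroup.subgroup_is_group)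
  have bij: "componentwise E f \<in> Bij E" if f: "f \<in> Bij (universe A)" for f
  proof -
    define g where "g = (\<lambda>x\<in>universe A. inv_into (universe A) f x)"
    have gB: "g \<in> Bij (universe A)" using restrict_inv_into_Bij[OF f] by (simp add: g_def)
    have b: "bij_betw f (universe A) (universe A)" using f by (auto simp: Bij_def)
    have fg: "f (g x) = x" "g (f x) = x" if "x \<in> universe A" for x
      using that b by (auto simp: g_def bij_betw_def f_inv_into_f)
    have m: "map f (map g t) = t" "map g (map f t) = t" if "t \<in> E" for t
      using len[OF that] fg by (auto intro!: map_idI)
    have "bij_betw (map f) E E"
      by (rule bij_betw_byWitness[where f' = "map g"]) (use m into[OF f] into[OF gB] in auto)
    then have "bij_betw (componentwise E f) E E"
      unfolding componentwise_def by (simp cong: bij_betw_cong)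
    then show ?thesis by (auto simp: Bij_def componentwise_def)
  qed
  have "componentwise E \<in> hom (Aut A) (BijGroup E)"
  proof (rule homI)
    fix f assume "f \<in> carrier (Aut A)"
    then show "componentwise E f \<in> carrier (BijGroup E)"
      using bij by (auto simp: Aut_def automorphisms_def BijGroup_def)
  next
    fix f g assume "f \<in> carrier (Aut A)" "g \<in> carrier (Aut A)"
    then have fB: "f \<in> Bij (universe A)" and gB: "g \<in> Bij (universe A)"
      by (auto simp: Aut_def automorphisms_def)
    have "componentwise E (compose (universe A) f g) =
        compose E (componentwise E f) (componentwise E g)"
    proof
      fix t
      show "componentwise E (compose (universe A) f g) t =
          compose E (componentwise E f) (componentwise E g) t"
      proof (cases "t \<in> E")
        case True
        then show ?thesis using len[OF True] into[OF gB True]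
          by (auto simp: componentwise_def compose_def)
      qed (simp add: componentwise_def compose_def)
    qed
    then show "componentwise E (f \<otimes>\<^bsub>Aut A\<^esub> g) =
        componentwise E f \<otimes>\<^bsub>BijGroup E\<^esub> componentwise E g"
      using fB gB bij by (simp add: Aut_def BijGroup_def)
  qed
  then show ?thesis
    unfolding group_action_def group_hom_def group_hom_axioms_def
    using grp group_BijGroup by blast
qed

section \<open>The classes of structures with small orbit growth\<close>

text \<open>Finiteness is stated explicitly because \<open>card\<close> is \<open>0\<close> on infinite sets.\<close>

definition K_exp :: "('s, 'a) rel_structure set" where
  "K_exp = {A. is_structure A \<and> countable (universe A) \<and>
     (\<exists>c::real. \<forall>n\<ge>1. finite (inj_tuple_orbits A n) \<and>
        real (card (inj_tuple_orbits A n)) \<le> c ^ n)}"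

definition K_exp_plus :: "('s, 'a) rel_structure set" where
  "K_exp_plus = {A. is_structure A \<and> countable (universe A) \<and>
     (\<exists>c d::real. d < 1 \<and> (\<forall>n\<ge>1. finite (inj_tuple_orbits A n) \<and>
        real (card (inj_tuple_orbits A n)) \<le> c * real n powr (d * real n)))}"

section \<open>Model-complete cores\<close>

definition omega_categorical :: "('s, 'a) rel_structure \<Rightarrow> bool" where
  "omega_categorical A \<longleftrightarrow>
     is_structure A \<and> countable (universe A) \<and> (\<forall>n. finite (tuple_orbits A n))"

definition Aut_dense_in_End :: "('s, 'a) rel_structure \<Rightarrow> bool" where
  "Aut_dense_in_End C \<longleftrightarrow>
     (\<forall>e \<in> endomorphisms C. \<forall>F. finite F \<and> F \<subseteq> universe C \<longrightarrow>
        (\<exists>a \<in> carrier (Aut C). \<forall>x\<in>F. e x = a x))"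

definition model_complete_core_of ::
  "('s, 'b) rel_structure \<Rightarrow> ('s, 'a) rel_structure \<Rightarrow> bool" where
  "model_complete_core_of C A \<longleftrightarrow>
     omega_categorical C \<and> hom_equivalent A C \<and> Aut_dense_in_End C"

section \<open>First-order definability and interdefinability\<close>

datatype 's formula =
    Falsum
  | Eq nat nat
  | Rel 's "nat list"
  | Neg "'s formula"
  | Conj "'s formula" "'s formula"
  | Ex nat "'s formula"

primrec free_vars :: "'s formula \<Rightarrow> nat set" where
  "free_vars Falsum = {}"
| "free_vars (Eq i j) = {i, j}"
| "free_vars (Rel s is) = set is"
| "free_vars (Neg \<phi>) = free_vars \<phi>"
| "free_vars (Conj \<phi> \<psi>) = free_vars \<phi> \<union> free_vars \<psi>"
| "free_vars (Ex i \<phi>) = free_vars \<phi> - {i}"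

primrec formula_over :: "('s \<Rightarrow> nat option) \<Rightarrow> 's formula \<Rightarrow> bool" where
  "formula_over S Falsum \<longleftrightarrow> True"
| "formula_over S (Eq i j) \<longleftrightarrow> True"
| "formula_over S (Rel s is) \<longleftrightarrow> S s = Some (length is)"
| "formula_over S (Neg \<phi>) \<longleftrightarrow> formula_over S \<phi>"
| "formula_over S (Conj \<phi> \<psi>) \<longleftrightarrow> formula_over S \<phi> \<and> formula_over S \<psi>"
| "formula_over S (Ex i \<phi>) \<longleftrightarrow> formula_over S \<phi>"

primrec sat :: "('s, 'a) rel_structure \<Rightarrow> (nat \<Rightarrow> 'a) \<Rightarrow> 's formula \<Rightarrow> bool" where
  "sat A v Falsum \<longleftrightarrow> False"
| "sat A v (Eq i j) \<longleftrightarrow> v i = v j"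
| "sat A v (Rel s is) \<longleftrightarrow> map v is \<in> interp A s"
| "sat A v (Neg \<phi>) \<longleftrightarrow> \<not> sat A v \<phi>"
| "sat A v (Conj \<phi> \<psi>) \<longleftrightarrow> sat A v \<phi> \<and> sat A v \<psi>"
| "sat A v (Ex i \<phi>) \<longleftrightarrow> (\<exists>x \<in> universe A. sat A (v(i := x)) \<phi>)"

text \<open>The free variables of \<open>\<phi>\<close> lie below \<open>k\<close>, so the values \<open>t ! i\<close> with \<open>i \<ge> k\<close> of the
  assignment play no role.\<close>

definition fo_definable :: "('s, 'a) rel_structure \<Rightarrow> nat \<Rightarrow> 'a list set \<Rightarrow> bool" where
  "fo_definable A k R \<longleftrightarrow>
     (\<exists>\<phi>. formula_over (sig A) \<phi> \<and> free_vars \<phi> \<subseteq> {..<k} \<and>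
        R = {t \<in> tuples (universe A) k. sat A (\<lambda>i. t ! i) \<phi>})"

definition interdefinable ::
  "('s, 'a) rel_structure \<Rightarrow> ('t, 'a) rel_structure \<Rightarrow> bool" where
  "interdefinable A B \<longleftrightarrow>
     is_structure A \<and> is_structure B \<and> universe A = universe B \<and>
     (\<forall>s k. sig A s = Some k \<longrightarrow> fo_definable B k (interp A s)) \<and>
     (\<forall>s k. sig B s = Some k \<longrightarrow> fo_definable A k (interp B s))"

definition M :: "('s, 'a) rel_structure \<Rightarrow> ('t, 'b) rel_structure set" where
  "M A = {B. \<exists>C :: ('s, 'b) rel_structure. model_complete_core_of C A \<and> interdefinable B C}"

end

theory Submission
  imports Defs
begin

text \<open>Let \<open>C\<close> be the model-complete core of \<open>A\<close>, with homomorphisms \<open>f\<close> from \<open>A\<close> to \<open>C\<close> and \<open>g\<close>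
  from \<open>C\<close> to \<open>A\<close>. For every automorphism \<open>a\<close> of \<open>A\<close> the map \<open>f \<circ> a \<circ> g\<close> is an endomorphism of
  \<open>C\<close>, so on each finite set it coincides with an automorphism of \<open>C\<close>. For \<open>a\<close> the identity this
  shows that \<open>g\<close> is injective, so \<open>g\<close> sends injective tuples of \<open>C\<close> to injective tuples of \<open>A\<close>.
  If \<open>a\<close> maps \<open>g t\<close> to \<open>g t'\<close>, then \<open>f (a (g t)) = f (g t')\<close>; the left side lies in the
  \<open>Aut C\<close>-orbit of \<open>t\<close>, the right side in that of \<open>t'\<close>, so \<open>t\<close> and \<open>t'\<close> have the same
  orbit. Hence \<open>C\<close> has at most as many orbits on injective \<open>n\<close>-tuples as \<open>A\<close>
  (\<open>card_inj_tuple_orbits_core_le\<close>), and any upper bound on the growth for \<open>A\<close> holds for \<open>C\<close> too.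

  Interdefinable structures have the same automorphisms (\<open>interdefinable_Aut_eq\<close>), because
  automorphisms preserve first-order formulas (\<open>sat_automorphism\<close>); so they have the same
  orbits.\<close>

section \<open>Interdefinable structures have the same automorphism group\<close>

text \<open>Asking that \<open>w\<close> agrees with \<open>a \<circ> v\<close> on the free variables only, instead of everywhere,
  covers assignments that read off a tuple and are arbitrary beyond its length.\<close>

lemma sat_automorphism:
  assumes a: "a \<in> automorphisms A" and "formula_over (sig A) \<phi>"
    and "\<And>i. i \<in> free_vars \<phi> \<Longrightarrow> v i \<in> universe A \<and> w i = a (v i)"
  shows "sat A w \<phi> \<longleftrightarrow> sat A v \<phi>"
  using assms(2,3)
proof (induction \<phi> arbitrary: v w)
  case (Eq i j)
  then show ?case
    using a by (auto simp: automorphisms_def Bij_def bij_betw_def inj_on_def)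
next
  case (Rel s "is")
  then have "map v is \<in> tuples (universe A) (length is)" "map w is = map a (map v is)"
    by (auto simp: tuples_def)
  moreover have "sig A s = Some (length is)" using Rel.prems by simp
  ultimately show ?case using automorphisms_preserve[OF a] by (metis sat.simps(3))
next
  case (Neg \<phi>)
  have "sat A w \<phi> \<longleftrightarrow> sat A v \<phi>" using Neg.prems by (intro Neg.IH) auto
  then show ?case by simp
next
  case (Conj \<phi> \<psi>)
  have "sat A w \<phi> \<longleftrightarrow> sat A v \<phi>" using Conj.prems by (intro Conj.IH(1)) auto
  moreover have "sat A w \<psi> \<longleftrightarrow> sat A v \<psi>" using Conj.prems by (intro Conj.IH(2)) auto
  ultimately show ?case by simp
next
  case (Ex i \<phi>)
  have step: "sat A (w(i := a x)) \<phi> \<longleftrightarrow> sat A (v(i := x)) \<phi>" if "x \<in> universe A" for x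
    using that Ex.prems by (intro Ex.IH) auto
  \<comment> \<open>Surjectivity of \<open>a\<close> lets the witness range over the values of \<open>a\<close>.\<close>
  have "a ` universe A = universe A"
    using a by (auto simp: automorphisms_def Bij_def bij_betw_def)
  then have "sat A w (Ex i \<phi>) \<longleftrightarrow> (\<exists>y \<in> a ` universe A. sat A (w(i := y)) \<phi>)"
    by simp
  then show ?case using step by auto
qed simp

lemma fo_definable_automorphism:
  assumes a: "a \<in> automorphisms A" and R: "fo_definable A k R" and t: "t \<in> tuples (universe A) k"
  shows "t \<in> R \<longleftrightarrow> map a t \<in> R"
proof -
  obtain \<phi> where \<phi>: "formula_over (sig A) \<phi>" "free_vars \<phi> \<subseteq> {..<k}"
    "R = {t \<in> tuples (universe A) k. sat A (\<lambda>i. t ! i) \<phi>}"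
    using R unfolding fo_definable_def by blast
  have "map a t \<in> tuples (universe A) k"
    using a t by (auto simp: tuples_def automorphisms_def Bij_def bij_betw_def)
  moreover have "sat A (\<lambda>i. map a t ! i) \<phi> \<longleftrightarrow> sat A (\<lambda>i. t ! i) \<phi>"
    using \<phi>(2) t by (intro sat_automorphism[OF a \<phi>(1)]) (auto simp: tuples_def subset_iff)
  ultimately show ?thesis using t \<phi>(3) by simp
qed

lemma automorphisms_subset_if_fo_definable:
  assumes "universe B = universe A"
    and "\<And>s k. sig B s = Some k \<Longrightarrow> fo_definable A k (interp B s)"
  shows "automorphisms A \<subseteq> automorphisms B"
proof
  fix a assume a: "a \<in> automorphisms A"
  then have "a \<in> Bij (universe B)" using assms(1) by (simp add: automorphisms_def)
  moreover have "t \<in> interp B s \<longleftrightarrow> map a t \<in> interp B s"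
    if "sig B s = Some k" "t \<in> tuples (universe B) k" for s k t
    using fo_definable_automorphism[OF a assms(2)] that assms(1) by simp
  ultimately show "a \<in> automorphisms B" by (simp add: automorphisms_def)
qed

lemma interdefinable_Aut_eq:
  assumes "interdefinable A B"
  shows "Aut A = Aut B"
proof -
  have "automorphisms A = automorphisms B"
    using assms unfolding interdefinable_def
    by (intro equalityI automorphisms_subset_if_fo_definable) auto
  then show ?thesis using assms by (simp add: Aut_def interdefinable_def)
qed

section \<open>Orbits of the core\<close>

text \<open>If \<open>p\<close> separates at least as much as \<open>q\<close>, then \<open>q\<close> factors through \<open>p\<close>.\<close>

lemma finite_card_image_le:
  assumes fin: "finite (p ` X)" and pq: "\<And>x y. x \<in> X \<Longrightarrow> y \<in> X \<Longrightarrow> p x = p y \<Longrightarrow> q x = q y"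
  shows "finite (q ` X) \<and> card (q ` X) \<le> card (p ` X)"
proof -
  have "q x = q (inv_into X p (p x))" if "x \<in> X" for x
    using that by (intro pq) (auto simp: inv_into_into f_inv_into_f)
  then have "q ` X = (\<lambda>u. q (inv_into X p u)) ` p ` X"
    by (simp add: image_image cong: image_cong)
  then show ?thesis using fin by (metis card_image_le finite_imageI)
qed

lemma compose_homomorphisms:
  assumes "sig A = sig B" "f \<in> homomorphisms A B" "g \<in> homomorphisms B C"
  shows "g \<circ> f \<in> homomorphisms A C"
  using assms by (auto simp: homomorphisms_def simp flip: map_map)

lemma automorphisms_subset_endomorphisms:
  assumes "is_structure A"
  shows "automorphisms A \<subseteq> endomorphisms A"
proof
  fix a assume "a \<in> automorphisms A"
  then show "a \<in> endomorphisms A"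
    using assms unfolding homomorphisms_def automorphisms_def is_structure_def
    by (fastforce simp: Bij_def bij_betw_def)
qed

lemma inj_tuple_orbits_eq_image:
  "inj_tuple_orbits A n =
    orbit (Aut A) (componentwise (inj_tuples (universe A) n)) ` inj_tuples (universe A) n"
  by (auto simp: inj_tuple_orbits_def orbits_def)

lemma orbit_inj_tuples_eq_iff:
  assumes t: "t \<in> inj_tuples (universe A) n" and u: "u \<in> inj_tuples (universe A) n"
  shows "orbit (Aut A) (componentwise (inj_tuples (universe A) n)) t =
      orbit (Aut A) (componentwise (inj_tuples (universe A) n)) u \<longleftrightarrow>
    (\<exists>a \<in> automorphisms A. map a t = u)"
proof -
  let ?E = "inj_tuples (universe A) n"
  interpret group_action "Aut A" ?E "componentwise ?E"
    by (rule componentwise_group_action[where n = n]) simp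
  have "(\<exists>a \<in> automorphisms A. map a t = u) \<longleftrightarrow> u \<in> orbit (Aut A) (componentwise ?E) t"
    using t by (auto simp: orbit_def componentwise_def Aut_def)
  also have "\<dots> \<longleftrightarrow>
      orbit (Aut A) (componentwise ?E) t = orbit (Aut A) (componentwise ?E) u" (is "_ \<longleftrightarrow> ?eq")
  proof
    assume "u \<in> orbit (Aut A) (componentwise ?E) t"
    moreover have "orbit (Aut A) (componentwise ?E) t \<in> orbits (Aut A) ?E (componentwise ?E)"
      "orbit (Aut A) (componentwise ?E) u \<in> orbits (Aut A) ?E (componentwise ?E)"
      using t u by (auto simp: orbits_def)
    ultimately show ?eq using orbit_refl[OF u] disjoint_union by blast
  next
    assume ?eq
    then show "u \<in> orbit (Aut A) (componentwise ?E) t" using orbit_refl[OF u] by simp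
  qed
  finally show ?thesis by simp
qed

text \<open>Density speaks of finite sets of points; applied to the finitely many entries of a tuple, it
  says that an endomorphism moves each tuple within its orbit.\<close>

lemma endomorphism_map_automorphism:
  assumes "Aut_dense_in_End C" "e \<in> endomorphisms C" "set t \<subseteq> universe C"
  obtains b where "b \<in> automorphisms C" "map e t = map b t"
proof -
  have "\<exists>b \<in> carrier (Aut C). \<forall>x \<in> set t. e x = b x"
    using assms by (auto simp: Aut_dense_in_End_def)
  then show ?thesis using that by (auto simp: Aut_def)
qed

text \<open>It suffices to look at two points at a time, that is, at pairs.\<close>

lemma endomorphism_inj_on:
  assumes "Aut_dense_in_End C" "e \<in> endomorphisms C"
  shows "inj_on e (universe C)"
proof (rule inj_onI)
  fix x y assume xy: "x \<in> universe C" "y \<in> universe C" "e x = e y"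
  obtain b where "b \<in> automorphisms C" "map e [x, y] = map b [x, y]"
    using endomorphism_map_automorphism[OF assms, of "[x, y]"] xy by auto
  then show "x = y" using xy by (auto simp: automorphisms_def Bij_def bij_betw_def inj_on_def)
qed

text \<open>The homomorphism from \<open>C\<close> to \<open>A\<close>, applied entrywise, need not respect \<open>Aut C\<close>-orbits and
  so need not induce a map between the orbit sets. It separates orbits, though: tuples from
  different orbits of \<open>C\<close> go to different orbits of \<open>A\<close>, which suffices for counting.\<close>

lemma card_inj_tuple_orbits_core_le:
  assumes A: "is_structure A" and fin: "finite (inj_tuple_orbits A n)"
    and hom: "hom_equivalent A C" and dense: "Aut_dense_in_End C"
  shows "finite (inj_tuple_orbits C n) \<and>
    card (inj_tuple_orbits C n) \<le> card (inj_tuple_orbits A n)"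
proof -
  let ?EA = "inj_tuples (universe A) n" and ?EC = "inj_tuples (universe C) n"
  let ?oA = "orbit (Aut A) (componentwise ?EA)" and ?oC = "orbit (Aut C) (componentwise ?EC)"
  obtain f g where f: "f \<in> homomorphisms A C" and g: "g \<in> homomorphisms C A"
    using hom by (auto simp: hom_equivalent_def)
  have sig: "sig A = sig C" using hom by (simp add: hom_equivalent_def)
  have fg: "f \<circ> g \<in> endomorphisms C"
    using compose_homomorphisms[OF sig[symmetric] g f] .
  have "inj_on g (universe C)"
    using endomorphism_inj_on[OF dense fg] by (rule inj_on_imageI2)
  then have gE: "map g t \<in> ?EA" if "t \<in> ?EC" for t
    using that g by (auto simp: inj_tuples_def tuples_def homomorphisms_def distinct_map
        intro: inj_on_subset)
  have orb: "?oC t = ?oC u"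
    if t: "t \<in> ?EC" and u: "u \<in> ?EC" and eq: "?oA (map g t) = ?oA (map g u)" for t u
  proof -
    obtain a where a: "a \<in> automorphisms A" and agt: "map a (map g t) = map g u"
      using eq orbit_inj_tuples_eq_iff[OF gE[OF t] gE[OF u]] by auto
    have "f \<circ> (a \<circ> g) \<in> endomorphisms C"
      using compose_homomorphisms[OF sig[symmetric] compose_homomorphisms[OF sig[symmetric] g] f]
        automorphisms_subset_endomorphisms[OF A] a by blast
    moreover have sub: "set t \<subseteq> universe C" "set u \<subseteq> universe C"
      using t u by (auto simp: inj_tuples_def tuples_def)
    ultimately obtain b where b: "b \<in> automorphisms C" "map (f \<circ> (a \<circ> g)) t = map b t"
      using endomorphism_map_automorphism[OF dense] by metis
    obtain b' where b': "b' \<in> automorphisms C" "map (f \<circ> g) u = map b' u"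
      using endomorphism_map_automorphism[OF dense fg sub(2)] .
    have same: "map b t = map b' u" using b(2) b'(2) agt by (metis map_map)
    have "map b t \<in> ?EC"
      using b(1) t sub by (auto simp: inj_tuples_def tuples_def automorphisms_def Bij_def
          bij_betw_def distinct_map intro: inj_on_subset)
    then have "?oC t = ?oC (map b t)" "?oC u = ?oC (map b t)"
      using orbit_inj_tuples_eq_iff[OF t] orbit_inj_tuples_eq_iff[OF u] b(1) b'(1) same by metis+
    then show ?thesis by simp
  qed
  have sub: "(\<lambda>t. ?oA (map g t)) ` ?EC \<subseteq> inj_tuple_orbits A n"
    using gE by (auto simp: inj_tuple_orbits_eq_image)
  have "finite (?oC ` ?EC) \<and> card (?oC ` ?EC) \<le> card ((\<lambda>t. ?oA (map g t)) ` ?EC)"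
    using finite_subset[OF sub fin] orb by (rule finite_card_image_le)
  then show ?thesis using card_mono[OF fin sub] by (simp add: inj_tuple_orbits_eq_image[of C])
qed

lemma card_inj_tuple_orbits_M_le:
  fixes A :: "('s, 'a) rel_structure" and B :: "('t, 'b) rel_structure"
  assumes "is_structure A" "B \<in> M A" "finite (inj_tuple_orbits A n)"
  shows "finite (inj_tuple_orbits B n) \<and>
    card (inj_tuple_orbits B n) \<le> card (inj_tuple_orbits A n)"
proof -
  obtain C :: "('s, 'b) rel_structure"
    where C: "model_complete_core_of C A" and BC: "interdefinable B C"
    using assms(2) by (auto simp: M_def)
  have "inj_tuple_orbits B n = inj_tuple_orbits C n"
    using interdefinable_Aut_eq[OF BC] BC by (simp add: inj_tuple_orbits_def interdefinable_def)
  moreover have "hom_equivalent A C" "Aut_dense_in_End C"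
    using C by (auto simp: model_complete_core_of_def)
  ultimately show ?thesis
    using card_inj_tuple_orbits_core_le[OF assms(1,3)] by metis
qed

lemma M_countable_structure:
  assumes "B \<in> M A"
  shows "is_structure B" "countable (universe B)"
  using assms by (auto simp: M_def interdefinable_def model_complete_core_of_def
      omega_categorical_def)

theorem corollary8p6:
  fixes A :: "('s, 'a) rel_structure"
  shows "(A \<in> K_exp \<longrightarrow> (M A :: ('t, 'b) rel_structure set) \<subseteq> K_exp) \<and>
         (A \<in> K_exp_plus \<longrightarrow> (M A :: ('t, 'b) rel_structure set) \<subseteq> K_exp_plus)"
proof -
  have bound: "finite (inj_tuple_orbits B n) \<and> real (card (inj_tuple_orbits B n)) \<le> r"
    if "is_structure A" "B \<in> M A"
      "finite (inj_tuple_orbits A n) \<and> real (card (inj_tuple_orbits A n)) \<le> r"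
    for B :: "('t, 'b) rel_structure" and n r
    using card_inj_tuple_orbits_M_le[of A B n] that by fastforce
  have "B \<in> K_exp" if A: "A \<in> K_exp" and B: "B \<in> M A" for B :: "('t, 'b) rel_structure"
    using A bound[OF _ B] M_countable_structure[OF B] unfolding K_exp_def by blast
  moreover have "B \<in> K_exp_plus" if A: "A \<in> K_exp_plus" and B: "B \<in> M A"
    for B :: "('t, 'b) rel_structure"
    using A bound[OF _ B] M_countable_structure[OF B] unfolding K_exp_plus_def by blast
  ultimately show ?thesis by blast
qed

end
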